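(* Let $G$ be a 2T-graph. Then there is a sequence of 2T-graphs $G_0,G_1,\dots,G_k$ where $G_0=G$, $G_k=K_1$, and $G_i=\tilde{G}_{i-1}$ (the quotient graph of $G_{i-1}$) for each $i=1,2,\dots,k$. In particular, $\tilde{G}$ is a 2T-graph.
   Context: Graphs may contain parallel edges but no loops. $G[X]$ is the subgraph of $G$ induced by $X$. A 2T-graph is a graph whose edge set is the union of two edge-disjoint spanning trees (the one-vertex graph $K_1$ counts as a 2T-graph, with two empty spanning trees). A graph $G=(V,E)$ is a generic circuit if $|E|=2|V|-2>0$ and $|E(G[X])|\le 2|X|-3$ for every $X\subset V$ with $2\le |X|\le |V|-1$. A generic circuit of a graph $G$ is an induced subgraph of $G$ which is a generic circuit. For a 2T-graph $G=(V,E)$ let $\mathcal{G}$ be the hypergraph on $V$ whose hyperedges are the vertex sets of the generic circuits of $G$. Two generic circuits of $G$ are connected if their vertex sets lie in the same connected component of $\mathcal{G}$. A generic component of $G$ is either a single vertex lying in no generic circuit of $G$ or the union of a maximal set of connected generic circuits. Distinct generic components are vertex-disjoint and together they cover $V$. The quotient graph $\tilde{G}$ of $G$ is the graph obtained from $G$ by contracting each generic component to a single vertex and deleting the loops resulting from the contractions (parallel edges are kept). *)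

theory Defs
  imports Main
begin

text \<open>
  Edges carry their own identity, so parallel edges are distinct edges with the same ends.
  (The trees of \<open>Graph_Theory\<close> are defined through directed cycles and do not fit undirected
  multigraphs.)
\<close>

record ('v, 'e) mgraph =
  verts :: "'v set"
  edges :: "'e set"
  ends :: "'e \<Rightarrow> 'v set"

definition multigraph :: "('v, 'e) mgraph \<Rightarrow> bool" where
  "multigraph G \<longleftrightarrow> finite (verts G) \<and> finite (edges G) \<and>
     (\<forall>e\<in>edges G. ends G e \<subseteq> verts G \<and> card (ends G e) = 2)"

definition induced :: "('v, 'e) mgraph \<Rightarrow> 'v set \<Rightarrow> ('v, 'e) mgraph" where
  "induced G X = \<lparr>verts = X, edges = {e \<in> edges G. ends G e \<subseteq> X}, ends = ends G\<rparr>"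

definition K1_graph :: "('v, 'e) mgraph \<Rightarrow> bool" where
  "K1_graph G \<longleftrightarrow> (\<exists>v. verts G = {v}) \<and> edges G = {}"


subsection \<open>Spanning trees and 2T-graphs\<close>

definition adjacency :: "('v, 'e) mgraph \<Rightarrow> ('v \<times> 'v) set" where
  "adjacency G = {(u, v). \<exists>e\<in>edges G. ends G e = {u, v}}"

definition connected_graph :: "('v, 'e) mgraph \<Rightarrow> bool" where
  "connected_graph G \<longleftrightarrow> verts G \<noteq> {} \<and>
     (\<forall>u\<in>verts G. \<forall>v\<in>verts G. (u, v) \<in> (adjacency G)\<^sup>*)"

text \<open>
  The cycle visits the vertices \<open>vs\<close> in cyclic order along the edges \<open>es\<close>;
  two parallel edges form a cycle of length 2.
\<close>

definition cycle :: "('v, 'e) mgraph \<Rightarrow> 'v list \<Rightarrow> 'e list \<Rightarrow> bool" where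
  "cycle G vs es \<longleftrightarrow> length vs = length es \<and> 2 \<le> length es \<and> distinct vs \<and> distinct es \<and>
     set vs \<subseteq> verts G \<and> set es \<subseteq> edges G \<and>
     (\<forall>i<length es. ends G (es ! i) = {vs ! i, vs ! (Suc i mod length es)})"

definition tree :: "('v, 'e) mgraph \<Rightarrow> bool" where
  "tree G \<longleftrightarrow> multigraph G \<and> connected_graph G \<and> \<not> (\<exists>vs es. cycle G vs es)"

definition spanning_tree :: "('v, 'e) mgraph \<Rightarrow> ('v, 'e) mgraph \<Rightarrow> bool" where
  "spanning_tree T G \<longleftrightarrow>
     tree T \<and> verts T = verts G \<and> edges T \<subseteq> edges G \<and> ends T = ends G"

definition two_T_graph :: "('v, 'e) mgraph \<Rightarrow> bool" where
  "two_T_graph G \<longleftrightarrow> multigraph G \<and>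
     (\<exists>T1 T2. spanning_tree T1 G \<and> spanning_tree T2 G \<and>
        edges T1 \<inter> edges T2 = {} \<and> edges G = edges T1 \<union> edges T2)"


subsection \<open>Generic circuits and generic components\<close>

text \<open>
  Subtraction on naturals is harmless here: \<open>card (edges G) > 0\<close> forces
  \<open>card (verts G) \<ge> 2\<close>, and the second bound is used only for \<open>card X \<ge> 2\<close>.
\<close>

definition generic_circuit :: "('v, 'e) mgraph \<Rightarrow> bool" where
  "generic_circuit G \<longleftrightarrow> multigraph G \<and>
     card (edges G) = 2 * card (verts G) - 2 \<and> card (edges G) > 0 \<and>
     (\<forall>X. X \<subset> verts G \<and> 2 \<le> card X \<and> card X \<le> card (verts G) - 1 \<longrightarrow>
        card (edges (induced G X)) \<le> 2 * card X - 3)"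

text \<open>
  A generic circuit of \<open>G\<close> is an induced subgraph, hence represented by its vertex set; the
  following set is thus also the set of hyperedges of the hypergraph of \<open>G\<close>.
\<close>

definition generic_circuits :: "('v, 'e) mgraph \<Rightarrow> 'v set set" where
  "generic_circuits G = {X. X \<subseteq> verts G \<and> generic_circuit (induced G X)}"

definition hypergraph_components :: "'v set \<Rightarrow> 'v set set \<Rightarrow> 'v set set" where
  "hypergraph_components V H = V // {(u, v). \<exists>X\<in>H. u \<in> X \<and> v \<in> X}\<^sup>*"

definition connected_circuits :: "('v, 'e) mgraph \<Rightarrow> 'v set \<Rightarrow> 'v set \<Rightarrow> bool" where
  "connected_circuits G X Y \<longleftrightarrow>
     (\<exists>C\<in>hypergraph_components (verts G) (generic_circuits G). X \<subseteq> C \<and> Y \<subseteq> C)"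

definition connected_circuit_set :: "('v, 'e) mgraph \<Rightarrow> 'v set set \<Rightarrow> bool" where
  "connected_circuit_set G S \<longleftrightarrow> S \<noteq> {} \<and> S \<subseteq> generic_circuits G \<and>
     (\<forall>X\<in>S. \<forall>Y\<in>S. connected_circuits G X Y)"

text \<open>Generic components are represented by their vertex sets.\<close>

definition generic_components :: "('v, 'e) mgraph \<Rightarrow> 'v set set" where
  "generic_components G =
     {{v} | v. v \<in> verts G \<and> v \<notin> \<Union>(generic_circuits G)} \<union>
     {\<Union>S | S. connected_circuit_set G S \<and>
        (\<forall>S'. connected_circuit_set G S' \<and> S \<subseteq> S' \<longrightarrow> S' = S)}"


subsection \<open>The quotient graph\<close>

text \<open>
  The vertex that a block \<open>C\<close> of the partition \<open>P\<close> is contracted to is named after some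
  element of \<open>C\<close>. This choice of names keeps the vertex type, so that the construction can
  be iterated; remaining edges keep their identity.
\<close>

definition contraction_map :: "'v set set \<Rightarrow> 'v \<Rightarrow> 'v" where
  "contraction_map P v = (SOME u. u \<in> (THE C. C \<in> P \<and> v \<in> C))"

definition contract :: "('v, 'e) mgraph \<Rightarrow> 'v set set \<Rightarrow> ('v, 'e) mgraph" where
  "contract G P =
     \<lparr>verts = contraction_map P ` verts G,
      edges = {e \<in> edges G. \<not> (\<exists>C\<in>P. ends G e \<subseteq> C)},
      ends = (\<lambda>e. contraction_map P ` ends G e)\<rparr>"

definition quotient_graph :: "('v, 'e) mgraph \<Rightarrow> ('v, 'e) mgraph" where
  "quotient_graph G = contract G (generic_components G)"

text \<open>
  The generic components partition the vertex set, so \<open>THE\<close> above denotes the component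
  containing \<open>v\<close>.
\<close>

lemma generic_components_partition:
  assumes "v \<in> verts G"
  shows "\<exists>!C. C \<in> generic_components G \<and> v \<in> C"
proof -
  define H where "H = generic_circuits G"
  define R where "R = {(u, v). \<exists>X\<in>H. u \<in> X \<and> v \<in> X}\<^sup>*"
  have "sym R" unfolding R_def by (rule sym_rtrancl) (auto intro!: symI)
  then have symR: "(y, x) \<in> R" if "(x, y) \<in> R" for x y
    using that by (rule symD)
  have transR: "(x, z) \<in> R" if "(x, y) \<in> R" "(y, z) \<in> R" for x y z
    using that unfolding R_def by (rule rtrancl_trans)
  have inR: "(x, y) \<in> R" if "X \<in> H" "x \<in> X" "y \<in> X" for x y X
    unfolding R_def by (rule r_into_rtrancl) (use that in auto)
  have sub: "X \<subseteq> verts G" if "X \<in> H" for X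
    using that by (auto simp: H_def generic_circuits_def)
  have ne: "X \<noteq> {}" if "X \<in> H" for X
    using that by (auto simp: H_def generic_circuits_def generic_circuit_def induced_def)
  have conn: "connected_circuits G X Y \<longleftrightarrow> (x, y) \<in> R"
    if XY: "X \<in> H" "Y \<in> H" and xy: "x \<in> X" "y \<in> Y" for X Y x y
  proof
    assume "connected_circuits G X Y"
    then obtain w where "(w, x) \<in> R" "(w, y) \<in> R"
      using xy unfolding connected_circuits_def hypergraph_components_def quotient_def
      by (auto simp: R_def H_def)
    then show "(x, y) \<in> R" using symR transR by blast
  next
    assume "(x, y) \<in> R"
    then have "X \<subseteq> R `` {x}" "Y \<subseteq> R `` {x}" using XY xy inR transR by blast+
    moreover have "R `` {x} \<in> hypergraph_components (verts G) (generic_circuits G)"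
      unfolding hypergraph_components_def R_def H_def[symmetric]
      by (rule quotientI) (use sub[OF XY(1)] xy(1) in blast)
    ultimately show "connected_circuits G X Y" unfolding connected_circuits_def by blast
  qed
  define K where "K x = {X \<in> H. \<exists>z\<in>X. (x, z) \<in> R}" for x
  have K_set: "connected_circuit_set G (K x)" if "X \<in> H" "x \<in> X" for x X
    unfolding connected_circuit_set_def
  proof (intro conjI ballI)
    show "K x \<noteq> {}" using that inR unfolding K_def by blast
    show "K x \<subseteq> generic_circuits G" by (auto simp: K_def H_def)
    fix Y Z assume "Y \<in> K x" "Z \<in> K x"
    then obtain y z where "Y \<in> H" "Z \<in> H" "y \<in> Y" "z \<in> Z" "(x, y) \<in> R" "(x, z) \<in> R"
      by (auto simp: K_def)
    then show "connected_circuits G Y Z" using conn[of Y Z y z] symR[of x y] transR[of y x z] by simp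
  qed
  have K_sup: "S \<subseteq> K x" if S: "connected_circuit_set G S" "X \<in> S" "x \<in> X" for S X x
  proof
    fix Y assume Y: "Y \<in> S"
    have "X \<in> H" "Y \<in> H" "connected_circuits G X Y"
      using S Y by (auto simp: connected_circuit_set_def H_def)
    moreover obtain y where "y \<in> Y" using ne[OF \<open>Y \<in> H\<close>] by blast
    ultimately show "Y \<in> K x" using conn[of X Y x y] S(3) unfolding K_def by blast
  qed
  have maxK: "S = K x"
    if S: "connected_circuit_set G S" "\<forall>S'. connected_circuit_set G S' \<and> S \<subseteq> S' \<longrightarrow> S' = S"
      "x \<in> \<Union>S" for S x
  proof -
    obtain X where X: "X \<in> S" "x \<in> X" using S(3) by blast
    then have "X \<in> H" using S(1) by (auto simp: connected_circuit_set_def H_def)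
    then have "connected_circuit_set G (K x)" using X(2) by (rule K_set)
    then show ?thesis using K_sup[OF S(1) X] S(2) by metis
  qed
  show ?thesis
  proof (cases "v \<in> \<Union>H")
    case False
    have "C = {v}" if "C \<in> generic_components G" "v \<in> C" for C
      using that False unfolding generic_components_def connected_circuit_set_def H_def by blast
    moreover have "{v} \<in> generic_components G"
      using False assms unfolding generic_components_def H_def by blast
    ultimately show ?thesis by blast
  next
    case True
    then obtain X where X: "X \<in> H" "v \<in> X" by blast
    have "C = \<Union>(K v)" if C: "C \<in> generic_components G" "v \<in> C" for C
    proof -
      obtain S where "C = \<Union>S" "connected_circuit_set G S"
        "\<forall>S'. connected_circuit_set G S' \<and> S \<subseteq> S' \<longrightarrow> S' = S"
        using C True unfolding generic_components_def H_def by blast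
      then show ?thesis using maxK[of S v] C(2) by simp
    qed
    moreover have XK: "X \<in> K v" using X inR unfolding K_def by blast
    moreover have "\<Union>(K v) \<in> generic_components G"
    proof -
      have "S' = K v" if "connected_circuit_set G S'" "K v \<subseteq> S'" for S'
      proof (rule antisym)
        show "S' \<subseteq> K v" using that XK X(2) by (intro K_sup[of S' X v]) auto
      qed (rule that)
      then show ?thesis
        unfolding generic_components_def by (intro UnI2 CollectI exI[of _ "K v"]) (simp add: K_set[OF X])
    qed
    ultimately show ?thesis using X(2) by (intro ex1I[of _ "\<Union>(K v)"]) blast+
  qed
qed

end

theory Submission
  imports Defs "HOL-Library.Disjoint_Sets"
begin

text \<open>
  Write \<open>i(X)\<close> for the number of edges with both ends in \<open>X\<close>. In a 2T-graph each of the two trees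
  has at most \<open>|X| - 1\<close> edges inside a nonempty set \<open>X\<close>, so \<open>i(X) \<le> 2|X| - 2\<close>. Call \<open>X\<close> tight if
  equality holds. Since \<open>i\<close> is supermodular, the union of two tight sets that share a vertex is tight
  (\<open>tight_Un\<close>). Single vertices and generic circuits are tight, and a generic component is obtained
  by gluing circuits along common vertices, so every generic component is tight
  (\<open>tight_generic_component\<close>).

  In a tight set both bounds \<open>|X| - 1\<close> are attained. A tree that has \<open>|C| - 1\<close> edges in every block \<open>C\<close>
  of a partition \<open>P\<close> keeps \<open>|P| - 1\<close> edges when the blocks are contracted, and it stays connected, so it
  contracts to a tree (\<open>tree_contract\<close>). Hence contracting tight blocks turns the two spanning trees
  into two spanning trees of the quotient, which is therefore a 2T-graph (\<open>two_T_contract\<close>).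

  The quotients reach \<open>K\<^sub>1\<close> because, in a 2T-graph with at least two vertices, the whole vertex set is
  tight, and a minimal tight set with at least two vertices is a generic circuit
  (\<open>ex_generic_circuit\<close>); contracting it lowers the number of vertices.

  All facts about trees come from one count: a graph with \<open>c\<close> connected components satisfies
  \<open>|V| \<le> c + |E|\<close>, with equality exactly when it has no cycle (\<open>forest_count\<close>).
\<close>

section \<open>Counting characterisation of forests and trees\<close>

definition acyclic_graph :: "('v, 'e) mgraph \<Rightarrow> bool" where
  "acyclic_graph G \<longleftrightarrow> \<not> (\<exists>vs es. cycle G vs es)"

definition delete_edge :: "'e \<Rightarrow> ('v, 'e) mgraph \<Rightarrow> ('v, 'e) mgraph" where
  "delete_edge e G = G\<lparr>edges := edges G - {e}\<rparr>"

definition components :: "('v, 'e) mgraph \<Rightarrow> 'v set set" where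
  "components G = verts G // (adjacency G)\<^sup>*"

lemma delete_edge_simps [simp]:
  "verts (delete_edge e G) = verts G" "edges (delete_edge e G) = edges G - {e}"
  "ends (delete_edge e G) = ends G"
  by (simp_all add: delete_edge_def)

lemma induced_simps [simp]:
  "verts (induced G X) = X" "edges (induced G X) = {e \<in> edges G. ends G e \<subseteq> X}"
  "ends (induced G X) = ends G"
  by (simp_all add: induced_def)

lemma contract_simps [simp]:
  "verts (contract G P) = contraction_map P ` verts G"
  "edges (contract G P) = {e \<in> edges G. \<not> (\<exists>C\<in>P. ends G e \<subseteq> C)}"
  "ends (contract G P) e = contraction_map P ` ends G e"
  by (simp_all add: contract_def)

lemma multigraph_delete_edge: "multigraph G \<Longrightarrow> multigraph (delete_edge e G)"
  by (auto simp: multigraph_def)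

lemma multigraph_induced: "multigraph G \<Longrightarrow> X \<subseteq> verts G \<Longrightarrow> multigraph (induced G X)"
  by (auto simp: multigraph_def intro: finite_subset)

lemma edge_ends:
  assumes "multigraph G" "e \<in> edges G"
  obtains u v where "ends G e = {u, v}" "u \<noteq> v" "u \<in> verts G" "v \<in> verts G"
proof -
  have "card (ends G e) = 2" "ends G e \<subseteq> verts G" using assms by (auto simp: multigraph_def)
  then show thesis using that by (auto simp: card_2_iff)
qed

lemma sym_adjacency: "sym (adjacency G)"
  by (auto simp: adjacency_def sym_def insert_commute)

lemma reach_sym: "(u, v) \<in> (adjacency G)\<^sup>* \<Longrightarrow> (v, u) \<in> (adjacency G)\<^sup>*"
  using sym_rtrancl[OF sym_adjacency] by (rule symD)

lemma adjacency_delete_edge: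
  assumes "e \<in> edges G" "ends G e = {u, v}"
  shows "adjacency G = insert (u, v) (insert (v, u) (adjacency (delete_edge e G)))"
  using assms by (auto simp: adjacency_def doubleton_eq_iff)

lemma cycle_mono:
  assumes "cycle H vs es" "verts H \<subseteq> verts G" "edges H \<subseteq> edges G" "ends H = ends G"
  shows "cycle G vs es"
  using assms by (auto simp: cycle_def)

text \<open>
  Going round the cycle the other way joins the ends of any of its edges; the closing edge, whose
  detour visits the vertices in list order, is the convenient one.
\<close>

lemma cycle_imp_nonbridge:
  assumes "cycle G vs es"
  shows "\<exists>e\<in>edges G. \<exists>u v. ends G e = {u, v} \<and> (u, v) \<in> (adjacency (delete_edge e G))\<^sup>*"
proof -
  define n where "n = length es - 1"
  have len: "length es = Suc n" and dist: "distinct es" and sub: "set es \<subseteq> edges G"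
    using assms by (auto simp: cycle_def n_def)
  have en: "ends G (es ! i) = {vs ! i, vs ! (Suc i mod Suc n)}" if "i < Suc n" for i
    using assms that len by (simp add: cycle_def)
  \<comment> \<open>The last edge returns from the last vertex to the first, since its index wraps around.\<close>
  let ?e = "es ! n"
  have "(vs ! 0, vs ! i) \<in> (adjacency (delete_edge ?e G))\<^sup>*" if "i \<le> n" for i
    using that
  proof (induction i)
    case (Suc i)
    have "es ! i \<noteq> ?e" using Suc.prems len dist by (simp add: nth_eq_iff_index_eq)
    moreover have "es ! i \<in> edges G" using sub len Suc.prems by (auto intro: nth_mem)
    ultimately have "(vs ! i, vs ! Suc i) \<in> adjacency (delete_edge ?e G)"
      using en[of i] Suc.prems by (auto simp: adjacency_def intro!: bexI[of _ "es ! i"])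
    then show ?case using Suc by (meson Suc_leD rtrancl.rtrancl_into_rtrancl)
  qed simp
  then have "(vs ! 0, vs ! n) \<in> (adjacency (delete_edge ?e G))\<^sup>*" by simp
  moreover have "ends G ?e = {vs ! 0, vs ! n}" using en[of n] by auto
  moreover have "?e \<in> edges G" using sub len by (auto intro: nth_mem)
  ultimately show ?thesis by blast
qed

text \<open>
  The definition of a cycle asks for distinct vertices, whereas reachability only yields a walk. If
  the next vertex of a walk already lies on the path built so far, the path is cut there.
\<close>

lemma rtrancl_simple_path:
  assumes "(u, v) \<in> r\<^sup>*"
  shows "\<exists>n f. f 0 = u \<and> f n = v \<and> inj_on f {..n} \<and> (\<forall>i<n. (f i, f (Suc i)) \<in> r)"
  using assms
proof (induction rule: rtrancl_induct)
  case base
  show ?case by (rule exI[of _ 0], rule exI[of _ "\<lambda>_. u"]) simp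
next
  case (step y z)
  then obtain n f where f: "f 0 = u" "f n = y" "inj_on f {..n}" "\<forall>i<n. (f i, f (Suc i)) \<in> r"
    by blast
  show ?case
  proof (cases "z \<in> f ` {..n}")
    case True
    then obtain i where "i \<le> n" "f i = z" by auto
    then show ?thesis using f
      by (intro exI[of _ i] exI[of _ f]) (auto intro: inj_on_subset)
  next
    case False
    define h where "h = f(Suc n := z)"
    have h: "h (Suc n) = z" "\<And>i. i \<le> n \<Longrightarrow> h i = f i" by (auto simp: h_def)
    have "inj_on h {..n} \<longleftrightarrow> inj_on f {..n}" "h ` {..n} = f ` {..n}"
      using h(2) by (auto intro!: inj_on_cong image_cong)
    then have "inj_on h {..Suc n}" using False f(3) h(1) by (simp add: atMost_Suc)
    moreover have "\<forall>i<Suc n. (h i, h (Suc i)) \<in> r"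
      using f step.hyps(2) h by (auto simp: less_Suc_eq)
    ultimately show ?thesis using f(1) h by (intro exI[of _ "Suc n"] exI[of _ h]) simp
  qed
qed

text \<open>
  A simple path that joins the ends of an edge and avoids that edge is closed to a cycle by it. If the
  ends have a second edge between them, the path may have length one and the cycle length two.
\<close>

lemma nonbridge_imp_cycle:
  assumes G: "multigraph G" and e: "e \<in> edges G" "ends G e = {u, v}"
    and uv: "(u, v) \<in> (adjacency (delete_edge e G))\<^sup>*"
  shows "\<exists>vs es. cycle G vs es"
proof -
  obtain n f where f: "f 0 = u" "f n = v" "inj_on f {..n}"
    and step: "\<forall>i<n. (f i, f (Suc i)) \<in> adjacency (delete_edge e G)"
    using rtrancl_simple_path[OF uv] by blast
  have "card {u, v} = 2" "{u, v} \<subseteq> verts G" using G e by (auto simp: multigraph_def)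
  then have "u \<noteq> v" and uvV: "u \<in> verts G" "v \<in> verts G" by auto
  then have n: "n \<noteq> 0" using f(1,2) by metis
  have "\<forall>i<n. \<exists>g. g \<in> edges G - {e} \<and> ends G g = {f i, f (Suc i)}"
    using step by (auto simp: adjacency_def)
  then obtain g where g: "\<And>i. i < n \<Longrightarrow> g i \<in> edges G - {e}"
    "\<And>i. i < n \<Longrightarrow> ends G (g i) = {f i, f (Suc i)}" by metis
  have ginj: "inj_on g {..<n}"
  proof (rule inj_onI)
    fix i j assume ij: "i \<in> {..<n}" "j \<in> {..<n}" "g i = g j"
    then have "{f i, f (Suc i)} = {f j, f (Suc j)}" using g(2)[of i] g(2)[of j] by auto
    moreover have "f i = f j \<longleftrightarrow> i = j" "f i = f (Suc j) \<longleftrightarrow> i = Suc j"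
      "f (Suc i) = f j \<longleftrightarrow> Suc i = j"
      using ij by (auto intro!: inj_on_eq_iff[OF f(3)])
    ultimately show "i = j" by (auto simp: doubleton_eq_iff)
  qed
  define vs where "vs = map f [0..<Suc n]"
  define es where "es = map g [0..<n] @ [e]"
  have "cycle G vs es"
    unfolding cycle_def
  proof (intro conjI allI impI)
    show "length vs = length es" "2 \<le> length es" using n by (auto simp: vs_def es_def)
    have "{0..<Suc n} = {..n}" by auto
    then show "distinct vs" using f(3) by (simp only: vs_def distinct_map set_upt) simp
    have "{0..<n} = {..<n}" by auto
    then show "distinct es" using ginj g(1) by (auto simp: es_def distinct_map)
    show "set es \<subseteq> edges G" using g(1) e by (auto simp: es_def)
    have "f i \<in> verts G" if "i \<le> n" for i
    proof (cases "i = n")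
      case False
      then have "g i \<in> edges G" "f i \<in> ends G (g i)" using g that by auto
      then show ?thesis using G by (auto simp: multigraph_def)
    qed (use uvV f in auto)
    then show "set vs \<subseteq> verts G" by (auto simp: vs_def less_Suc_eq_le)
    fix i assume i: "i < length es"
    show "ends G (es ! i) = {vs ! i, vs ! (Suc i mod length es)}"
    proof (cases "i = n")
      case True
      then show ?thesis using e f by (auto simp: es_def vs_def nth_append simp del: upt_Suc)
    next
      case False
      then have "i < n" using i by (simp add: es_def)
      then show ?thesis using g(2)[of i]
        by (simp add: es_def vs_def nth_append del: upt_Suc)
    qed
  qed
  then show ?thesis by blast
qed

text \<open>
  The detour between the ends replaces the edge in every walk, so reachability does not change.
\<close>

lemma components_delete_nonbridge:
  assumes "e \<in> edges G" "ends G e = {u, v}" and uv: "(u, v) \<in> (adjacency (delete_edge e G))\<^sup>*"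
  shows "components (delete_edge e G) = components G"
proof -
  let ?r = "adjacency (delete_edge e G)"
  have "(insert (u, v) (insert (v, u) ?r))\<^sup>* = ?r\<^sup>*"
  proof (rule rtrancl_subset)
    show "?r \<subseteq> insert (u, v) (insert (v, u) ?r)" by blast
    show "insert (u, v) (insert (v, u) ?r) \<subseteq> ?r\<^sup>*" using uv reach_sym by auto
  qed
  then show ?thesis using adjacency_delete_edge[OF assms(1,2)] by (simp add: components_def)
qed

lemma reach_in_verts:
  assumes "multigraph G" "(u, v) \<in> (adjacency G)\<^sup>*" "u \<in> verts G"
  shows "v \<in> verts G"
  using assms(2,3)
  by (induction rule: rtrancl_induct) (use assms(1) in \<open>auto simp: adjacency_def multigraph_def\<close>)

lemma finite_components: "multigraph G \<Longrightarrow> finite (components G)"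
  by (simp add: components_def quotient_def multigraph_def)

text \<open>
  Putting a bridge back merges the two distinct classes of its ends and leaves all others alone.
\<close>

lemma card_components_delete_bridge:
  assumes G: "multigraph G" and e: "e \<in> edges G" "ends G e = {u, v}"
    and uv: "(u, v) \<notin> (adjacency (delete_edge e G))\<^sup>*"
  shows "card (components (delete_edge e G)) = Suc (card (components G))"
proof -
  let ?r = "adjacency (delete_edge e G)" and ?H = "delete_edge e G"
  define c where "c x = ?r\<^sup>* `` {x}" for x
  have c_eq: "c x = c y" if "(x, y) \<in> ?r\<^sup>*" for x y
    using that reach_sym[OF that] by (auto simp: c_def intro: rtrancl_trans)
  have c_self: "x \<in> c x" for x by (simp add: c_def)
  have c_iff: "y \<in> c x \<longleftrightarrow> c x = c y" for x y
    using c_eq[of x y] c_self[of y] by (auto simp: c_def)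
  have reach: "(x, y) \<in> (adjacency G)\<^sup>* \<longleftrightarrow> 
     y \<in> c x \<or> (x \<in> c u \<and> y \<in> c v) \<or> (x \<in> c v \<and> y \<in> c u)" for x y
    unfolding adjacency_delete_edge[OF e] rtrancl_insert using uv
    by (auto simp: c_def dest: reach_sym intro: rtrancl_trans)
  have uvV: "u \<in> verts G" "v \<in> verts G" using G e by (auto simp: multigraph_def)
  have ne: "c u \<noteq> c v" using uv c_self[of v] by (auto simp: c_def)
  have cls: "(adjacency G)\<^sup>* `` {x} = (if c x \<in> {c u, c v} then c u \<union> c v else c x)" for x
  proof -
    have "y \<in> (adjacency G)\<^sup>* `` {x} \<longleftrightarrow>
        y \<in> (if c x \<in> {c u, c v} then c u \<union> c v else c x)" for y
      by (simp add: reach c_iff) (metis ne)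
    then show ?thesis by blast
  qed
  have old: "components ?H = c ` verts G" by (auto simp: components_def quotient_def c_def)
  have "components G = insert (c u \<union> c v) (components ?H - {c u, c v})"
  proof -
    have merge: "(\<lambda>x. if c x \<in> S then t else c x) ` V = insert t (c ` V - S)"
      if "u \<in> V" "c u \<in> S" for S V t
      using that by (auto simp: image_iff)
    have "components G = (\<lambda>x. (adjacency G)\<^sup>* `` {x}) ` verts G"
      by (auto simp: components_def quotient_def)
    also have "\<dots> = (\<lambda>x. if c x \<in> {c u, c v} then c u \<union> c v else c x) ` verts G"
      by (simp only: cls)
    finally show ?thesis using merge[OF uvV(1), of "{c u, c v}"] old by simp
  qed
  moreover have "c u \<union> c v \<notin> components ?H"
  proof
    assume "c u \<union> c v \<in> components ?H"
    then obtain x where x: "c x = c u \<union> c v" by (auto simp: old)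
    then have "u \<in> c x" "v \<in> c x" using c_self by auto
    then show False using ne by (simp add: c_iff)
  qed
  moreover have "finite (components ?H)"
    using G by (intro finite_components multigraph_delete_edge)
  moreover have "{c u, c v} \<subseteq> components ?H" using uvV by (simp add: old)
  moreover from calculation(3,4) have "card (components ?H) \<ge> card {c u, c v}"
    by (rule card_mono)
  ultimately show ?thesis using ne by (simp add: card_Diff_subset)
qed

text \<open>
  Delete edges one by one. The quantity \<open>c + |E|\<close> stays constant when a bridge goes and drops by one
  when another edge goes; with no edges left it is \<open>|V|\<close>. A graph has a cycle exactly when
  some edge is not a bridge, so cycles are what makes the inequality strict.
\<close>

lemma forest_count:
  assumes "multigraph G"
  shows "card (verts G) \<le> card (components G) + card (edges G) \<and>
    (acyclic_graph G \<longleftrightarrow> card (verts G) = card (components G) + card (edges G))"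
  using assms
proof (induction "card (edges G)" arbitrary: G)
  case 0
  then have "edges G = {}" by (simp add: multigraph_def)
  moreover from this have "components G = (\<lambda>x. {x}) ` verts G"
    by (auto simp: components_def adjacency_def quotient_def)
  then have "card (components G) = card (verts G)" by (simp add: card_image)
  moreover have "acyclic_graph G"
    using \<open>edges G = {}\<close> by (auto simp: acyclic_graph_def cycle_def)
  ultimately show ?case by simp
next
  case (Suc n)
  have fin: "finite (edges G)" using Suc.prems by (simp add: multigraph_def)
  have IH: "card (verts G) \<le> card (components (delete_edge e G)) + n"
    "acyclic_graph (delete_edge e G) \<longleftrightarrow> card (verts G) = card (components (delete_edge e G)) + n"
    if "e \<in> edges G" for e
  proof -
    have "n = card (edges (delete_edge e G))" using Suc.hyps(2)[symmetric] that fin by simp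
    from Suc.hyps(1)[OF this multigraph_delete_edge[OF Suc.prems]] this
    show "card (verts G) \<le> card (components (delete_edge e G)) + n"
      "acyclic_graph (delete_edge e G) \<longleftrightarrow> card (verts G) = card (components (delete_edge e G)) + n"
      by simp_all
  qed
  show ?case
  proof (cases "acyclic_graph G")
    case False
    \<comment> \<open>Deleting a bridge would not change the gap in the bound; a non-bridge makes it positive.\<close>
    then obtain e u v where e: "e \<in> edges G" "ends G e = {u, v}"
      "(u, v) \<in> (adjacency (delete_edge e G))\<^sup>*"
      using cycle_imp_nonbridge unfolding acyclic_graph_def by blast
    show ?thesis using False IH(1)[OF e(1)] Suc.hyps(2)
      by (simp add: components_delete_nonbridge[OF e])
  next
    case True
    obtain e where e: "e \<in> edges G" using Suc.hyps(2) by fastforce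
    obtain u v where uv: "ends G e = {u, v}" using edge_ends[OF Suc.prems e] by blast
    have "(u, v) \<notin> (adjacency (delete_edge e G))\<^sup>*"
      using True nonbridge_imp_cycle[OF Suc.prems e uv] by (auto simp: acyclic_graph_def)
    note card_components_delete_bridge[OF Suc.prems e uv this]
    moreover have "acyclic_graph (delete_edge e G)"
      using True cycle_mono[of "delete_edge e G" _ _ G] by (auto simp: acyclic_graph_def)
    ultimately show ?thesis using True IH(2)[OF e] Suc.hyps(2) by simp
  qed
qed

lemma card_components_connected:
  assumes "multigraph G" "connected_graph G"
  shows "card (components G) = 1"
proof -
  obtain v where v: "v \<in> verts G" using assms(2) by (auto simp: connected_graph_def)
  have "(adjacency G)\<^sup>* `` {x} = verts G" if "x \<in> verts G" for x
    using assms that by (auto simp: connected_graph_def dest: reach_in_verts)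
  then have "components G = {verts G}" using v by (auto simp: components_def quotient_def)
  then show ?thesis by simp
qed

lemma tree_iff_card:
  assumes "multigraph G" "connected_graph G"
  shows "tree G \<longleftrightarrow> card (edges G) + 1 = card (verts G)"
  using forest_count[OF assms(1)] card_components_connected[OF assms] assms
  by (auto simp: tree_def acyclic_graph_def)

text \<open>
  The induced subgraph is again without cycles, and it has at least one component.
\<close>

lemma forest_sparse:
  assumes "tree T" "X \<subseteq> verts T" "X \<noteq> {}"
  shows "card (edges (induced T X)) + 1 \<le> card X"
proof -
  have "multigraph T" using assms(1) by (simp add: tree_def)
  then have m: "multigraph (induced T X)" using assms(2) by (rule multigraph_induced)
  have "acyclic_graph (induced T X)"
    using assms cycle_mono[of "induced T X" _ _ T] by (auto simp: acyclic_graph_def tree_def)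
  moreover have "components (induced T X) \<noteq> {}"
    using assms(3) by (auto simp: components_def quotient_def)
  then have "card (components (induced T X)) \<noteq> 0" using finite_components[OF m] by simp
  ultimately show ?thesis using forest_count[OF m] by simp
qed

section \<open>Contraction of a tree\<close>

lemma block_eq_THE:
  assumes "partition_on V P" "C \<in> P" "v \<in> C"
  shows "(THE C. C \<in> P \<and> v \<in> C) = C"
  using assms by (intro the_equality) (auto simp: partition_on_def disjoint_def)

text \<open>
  The name chosen for a block lies in that block, and distinct blocks are disjoint, so distinct blocks
  get distinct names.
\<close>

lemma contraction_map_eq_iff:
  assumes P: "partition_on V P" and C: "C \<in> P" "u \<in> C" and D: "D \<in> P" "v \<in> D"
  shows "contraction_map P u = contraction_map P v \<longleftrightarrow> C = D"
proof
  have u: "contraction_map P u \<in> C"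
    unfolding contraction_map_def block_eq_THE[OF P C] using C(2) by (rule someI)
  have v: "contraction_map P v \<in> D"
    unfolding contraction_map_def block_eq_THE[OF P D] using D(2) by (rule someI)
  show "C = D" if "contraction_map P u = contraction_map P v"
    using that u v P C D by (auto simp: partition_on_def disjoint_def)
  show "contraction_map P u = contraction_map P v" if "C = D"
    unfolding contraction_map_def block_eq_THE[OF P C] block_eq_THE[OF P D] by (simp add: that)
qed

lemma card_contraction_map_image:
  assumes P: "partition_on V P"
  shows "card (contraction_map P ` V) = card P"
proof -
  have "bij_betw (\<lambda>C. SOME u. u \<in> C) P (contraction_map P ` V)"
    unfolding bij_betw_def
  proof
    have *: "(SOME u. u \<in> C) \<in> C" if "C \<in> P" for C
      using that P by (auto simp: partition_on_def some_in_eq)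
    show "inj_on (\<lambda>C. SOME u. u \<in> C) P"
    proof (rule inj_onI)
      fix C D assume CD: "C \<in> P" "D \<in> P" "(SOME u. u \<in> C) = (SOME u. u \<in> D)"
      then have "C \<inter> D \<noteq> {}" using *[OF CD(1)] *[OF CD(2)] by auto
      then show "C = D" using CD P by (auto simp: partition_on_def disjoint_def)
    qed
    have cm: "contraction_map P v = (SOME u. u \<in> C)" if "C \<in> P" "v \<in> C" for C v
      by (simp add: contraction_map_def block_eq_THE[OF P that])
    show "(\<lambda>C. SOME u. u \<in> C) ` P = contraction_map P ` V"
    proof (intro equalityI subsetI)
      fix x assume "x \<in> (\<lambda>C. SOME u. u \<in> C) ` P"
      then obtain C where "C \<in> P" "x = (SOME u. u \<in> C)" by blast
      then have "x = contraction_map P x" "x \<in> V"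
        using * cm P by (auto simp: partition_on_def)
      then show "x \<in> contraction_map P ` V" by blast
    next
      fix x assume "x \<in> contraction_map P ` V"
      then obtain v C where "x = contraction_map P v" "C \<in> P" "v \<in> C"
        using P by (auto simp: partition_on_def)
      then show "x \<in> (\<lambda>C. SOME u. u \<in> C) ` P" using cm by auto
    qed
  qed
  then show ?thesis by (metis bij_betw_same_card)
qed

lemma multigraph_contract:
  assumes G: "multigraph G" and P: "partition_on (verts G) P"
  shows "multigraph (contract G P)"
  unfolding multigraph_def
proof (intro conjI ballI)
  show "finite (verts (contract G P))" "finite (edges (contract G P))"
    using G by (simp_all add: multigraph_def)
  fix e assume e: "e \<in> edges (contract G P)"
  then obtain u v where uv: "ends G e = {u, v}" "u \<in> verts G" "v \<in> verts G"
    using edge_ends[OF G, of e] by (metis (lifting) contract_simps(2) mem_Collect_eq)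
  then show "ends (contract G P) e \<subseteq> verts (contract G P)" by simp
  obtain C D where CD: "C \<in> P" "u \<in> C" "D \<in> P" "v \<in> D"
    using uv(2,3) partition_onD1[OF P] by blast
  then have "C \<noteq> D" using e uv by auto
  then have "contraction_map P u \<noteq> contraction_map P v"
    using contraction_map_eq_iff[OF P CD] by simp
  then show "card (ends (contract G P) e) = 2" by (simp add: uv)
qed

lemma connected_contract:
  assumes G: "connected_graph G" and P: "partition_on (verts G) P"
  shows "connected_graph (contract G P)"
proof -
  let ?p = "contraction_map P"
  have "(?p u, ?p v) \<in> (adjacency (contract G P))\<^sup>*" if "(u, v) \<in> (adjacency G)\<^sup>*" for u v
    using that
  proof (induction rule: rtrancl_induct)
    case (step y z)
    then obtain e where e: "e \<in> edges G" "ends G e = {y, z}" by (auto simp: adjacency_def)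
    show ?case
    proof (cases "\<exists>C\<in>P. ends G e \<subseteq> C")
      case True
      then obtain C where "C \<in> P" "y \<in> C" "z \<in> C" using e by auto
      then have "?p y = ?p z" using contraction_map_eq_iff[OF P] by blast
      then show ?thesis using step by simp
    next
      case False
      then have "(?p y, ?p z) \<in> adjacency (contract G P)"
        using e by (auto simp: adjacency_def intro!: exI[of _ e])
      then show ?thesis using step by simp
    qed
  qed simp
  then show ?thesis using G by (auto simp: connected_graph_def)
qed

lemma card_edges_contract:
  assumes G: "multigraph G" and P: "partition_on (verts G) P"
  shows "card (edges (contract G P)) + (\<Sum>C\<in>P. card (edges (induced G C))) = card (edges G)"
proof -
  have fin: "finite (edges G)" "finite P"
    using G finite_elements[OF _ P] by (auto simp: multigraph_def)
  have "card (\<Union>C\<in>P. edges (induced G C)) = (\<Sum>C\<in>P. card (edges (induced G C)))"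
  proof (rule card_UN_disjoint)
    show "\<forall>C\<in>P. \<forall>D\<in>P. C \<noteq> D \<longrightarrow> edges (induced G C) \<inter> edges (induced G D) = {}"
    proof (intro ballI impI)
      fix C D assume CD: "C \<in> P" "D \<in> P" "C \<noteq> D"
      then have "C \<inter> D = {}" using P by (auto simp: partition_on_def disjoint_def)
      moreover have "ends G e \<noteq> {}" if "e \<in> edges G" for e
        using edge_ends[OF G that] by blast
      ultimately show "edges (induced G C) \<inter> edges (induced G D) = {}"
        by (simp add: disjoint_iff) blast
    qed
  qed (use fin in auto)
  moreover have "edges G = edges (contract G P) \<union> (\<Union>C\<in>P. edges (induced G C))" by auto
  then have "card (edges G) = card (edges (contract G P) \<union> (\<Union>C\<in>P. edges (induced G C)))"
    by (rule arg_cong)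
  moreover have "\<dots> = card (edges (contract G P)) + card (\<Union>C\<in>P. edges (induced G C))"
    using fin by (intro card_Un_disjoint) auto
  ultimately show ?thesis by simp
qed

text \<open>
  The blocks contain \<open>|V| - |P|\<close> of the \<open>|V| - 1\<close> edges, so \<open>|P| - 1\<close> edges survive on \<open>|P|\<close> vertices; a
  connected graph with these numbers is a tree.
\<close>

lemma tree_contract:
  assumes T: "tree T" and P: "partition_on (verts T) P"
    and block: "\<And>C. C \<in> P \<Longrightarrow> card (edges (induced T C)) + 1 = card C"
  shows "tree (contract T P)"
proof -
  have m: "multigraph T" "connected_graph T" using T by (auto simp: tree_def)
  have fin: "finite (verts T)" using m by (simp add: multigraph_def)
  have "card (verts T) = (\<Sum>C\<in>P. card C)"
  proof -
    have "finite C" if "C \<in> P" for C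
      using that P fin by (auto simp: partition_on_def intro: finite_subset)
    then have "card (\<Union>P) = (\<Sum>C\<in>P. card C)"
      using P by (intro card_Union_disjoint) (auto simp: partition_on_def disjoint_def pairwise_def disjnt_def)
    then show ?thesis using P by (simp add: partition_on_def)
  qed
  also have "\<dots> = (\<Sum>C\<in>P. card (edges (induced T C))) + card P"
    by (simp add: block[symmetric] sum_Suc del: induced_simps)
  finally have "card (edges (contract T P)) + 1 = card P"
    using card_edges_contract[OF m(1) P] tree_iff_card[OF m] T by linarith
  then have "card (edges (contract T P)) + 1 = card (verts (contract T P))"
    using card_contraction_map_image[OF P] by simp
  then show ?thesis
    using tree_iff_card[OF multigraph_contract[OF m(1) P] connected_contract[OF m(2) P]] by blast
qed

section \<open>Tight sets\<close>

definition tight :: "('v, 'e) mgraph \<Rightarrow> 'v set \<Rightarrow> bool" where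
  "tight G X \<longleftrightarrow> X \<noteq> {} \<and> X \<subseteq> verts G \<and> card (edges (induced G X)) + 2 = 2 * card X"

lemma card_edges_two_trees:
  assumes G: "multigraph G" and disj: "edges T1 \<inter> edges T2 = {}"
    and E: "edges G = edges T1 \<union> edges T2" "ends T1 = ends G" "ends T2 = ends G"
  shows "card (edges (induced G X)) = card (edges (induced T1 X)) + card (edges (induced T2 X))"
proof -
  have "edges (induced G X) = edges (induced T1 X) \<union> edges (induced T2 X)" using E by auto
  moreover have "finite (edges (induced T1 X))" "finite (edges (induced T2 X))"
    using G E by (auto simp: multigraph_def)
  ultimately show ?thesis using disj by (simp add: card_Un_disjoint disjoint_iff)
qed

lemma two_T_sparse:
  assumes "two_T_graph G" "X \<subseteq> verts G" "X \<noteq> {}"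
  shows "card (edges (induced G X)) + 2 \<le> 2 * card X"
proof -
  obtain T1 T2 where T: "spanning_tree T1 G" "spanning_tree T2 G" "edges T1 \<inter> edges T2 = {}"
    "edges G = edges T1 \<union> edges T2" and G: "multigraph G"
    using assms(1) by (auto simp: two_T_graph_def)
  then have "card (edges (induced G X)) = card (edges (induced T1 X)) + card (edges (induced T2 X))"
    by (intro card_edges_two_trees) (auto simp: spanning_tree_def)
  moreover have "card (edges (induced T1 X)) + 1 \<le> card X" "card (edges (induced T2 X)) + 1 \<le> card X"
    by (rule forest_sparse; use T assms in \<open>simp add: spanning_tree_def\<close>)+
  ultimately show ?thesis by linarith
qed

lemma two_T_verts:
  assumes "two_T_graph G"
  shows "multigraph G" "finite (verts G)" "verts G \<noteq> {}"
  using assms by (auto simp: two_T_graph_def multigraph_def spanning_tree_def tree_def connected_graph_def)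

lemma tight_verts:
  assumes "two_T_graph G"
  shows "tight G (verts G)"
proof -
  obtain T1 T2 where T: "spanning_tree T1 G" "spanning_tree T2 G" "edges T1 \<inter> edges T2 = {}"
    "edges G = edges T1 \<union> edges T2" and G: "multigraph G"
    using assms(1) by (auto simp: two_T_graph_def)
  have "card (edges T) + 1 = card (verts G)" if "spanning_tree T G" for T
    using that tree_iff_card[of T] by (auto simp: spanning_tree_def tree_def)
  then have "card (edges T1) + 1 = card (verts G)" "card (edges T2) + 1 = card (verts G)"
    using T by auto
  moreover have "card (edges G) = card (edges T1) + card (edges T2)"
    using T G by (simp add: card_Un_disjoint multigraph_def)
  moreover have "{e \<in> edges G. ends G e \<subseteq> verts G} = edges G" using G by (auto simp: multigraph_def)
  ultimately show ?thesis using two_T_verts[OF assms] by (simp add: tight_def)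
qed

lemma tight_singleton:
  assumes "multigraph G" "v \<in> verts G"
  shows "tight G {v}"
proof -
  have "edges (induced G {v}) = {}"
  proof -
    have False if "e \<in> edges G" "ends G e \<subseteq> {v}" for e
      by (rule edge_ends[OF assms(1) that(1)]) (use that(2) in auto)
    then show ?thesis by auto
  qed
  then have "card (edges (induced G {v})) = 0" by (simp only: card.empty)
  then show ?thesis using assms(2) unfolding tight_def by simp
qed

text \<open>
  An edge inside \<open>X\<close> or inside \<open>Y\<close> lies inside \<open>X \<union> Y\<close>, and one inside both lies inside \<open>X \<inter> Y\<close>, so
  \<open>i(X) + i(Y) \<le> i(X \<union> Y) + i(X \<inter> Y)\<close>. As \<open>X \<inter> Y\<close> is nonempty, both terms on the right obey the
  sparsity bound, and tightness of \<open>X\<close> and \<open>Y\<close> forces equality in both.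
\<close>

lemma tight_Un:
  assumes G: "two_T_graph G" and X: "tight G X" and Y: "tight G Y" and XY: "X \<inter> Y \<noteq> {}"
  shows "tight G (X \<union> Y)"
proof -
  let ?i = "\<lambda>Z. card (edges (induced G Z))"
  have fin: "finite (edges G)" "finite (verts G)"
    using two_T_verts[OF G] by (auto simp: multigraph_def)
  have sub: "X \<subseteq> verts G" "Y \<subseteq> verts G" using X Y by (auto simp: tight_def)
  then have finXY: "finite X" "finite Y" using fin by (auto intro: finite_subset)
  have "?i X + ?i Y = card (edges (induced G X) \<union> edges (induced G Y)) +
      card (edges (induced G X) \<inter> edges (induced G Y))"
    using fin by (intro card_Un_Int) auto
  also have "\<dots> \<le> ?i (X \<union> Y) + ?i (X \<inter> Y)"
    using fin by (intro add_mono card_mono) auto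
  finally have "?i X + ?i Y \<le> ?i (X \<union> Y) + ?i (X \<inter> Y)" .
  moreover have "?i (X \<inter> Y) + 2 \<le> 2 * card (X \<inter> Y)" "?i (X \<union> Y) + 2 \<le> 2 * card (X \<union> Y)"
    by (rule two_T_sparse[OF G]; use XY sub in blast)+
  moreover have "card X + card Y = card (X \<union> Y) + card (X \<inter> Y)"
    by (rule card_Un_Int[OF finXY])
  moreover have "?i X + 2 = 2 * card X" "?i Y + 2 = 2 * card Y" using X Y by (auto simp: tight_def)
  ultimately have "?i (X \<union> Y) + 2 = 2 * card (X \<union> Y)" by linarith
  then show ?thesis using sub XY by (auto simp: tight_def)
qed

text \<open>
  In a tight block the two trees together have \<open>2|C| - 2\<close> edges and each has at most \<open>|C| - 1\<close>, so each
  has exactly that many and contracts to a spanning tree of the quotient.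
\<close>

lemma two_T_contract:
  assumes G: "two_T_graph G" and P: "partition_on (verts G) P"
    and tight: "\<And>C. C \<in> P \<Longrightarrow> tight G C"
  shows "two_T_graph (contract G P)"
proof -
  obtain T1 T2 where T: "spanning_tree T1 G" "spanning_tree T2 G" "edges T1 \<inter> edges T2 = {}"
    "edges G = edges T1 \<union> edges T2" and mG: "multigraph G"
    using G by (auto simp: two_T_graph_def)
  have block: "card (edges (induced T1 C)) + 1 = card C" "card (edges (induced T2 C)) + 1 = card C"
    if "C \<in> P" for C
  proof -
    have "tight G C" using tight[OF that] .
    then have C: "C \<subseteq> verts G" "C \<noteq> {}" "card (edges (induced G C)) + 2 = 2 * card C"
      unfolding tight_def by blast+
    have "card (edges (induced G C)) = card (edges (induced T1 C)) + card (edges (induced T2 C))"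
      using T mG by (intro card_edges_two_trees) (auto simp: spanning_tree_def)
    moreover have "card (edges (induced T1 C)) + 1 \<le> card C" "card (edges (induced T2 C)) + 1 \<le> card C"
      by (rule forest_sparse; use T C in \<open>simp add: spanning_tree_def\<close>)+
    ultimately show "card (edges (induced T1 C)) + 1 = card C"
      "card (edges (induced T2 C)) + 1 = card C" using C(3) by linarith+
  qed
  have span: "spanning_tree (contract T P) (contract G P)"
    if "spanning_tree T G" "\<And>C. C \<in> P \<Longrightarrow> card (edges (induced T C)) + 1 = card C" for T
  proof -
    have "tree (contract T P)" using that P by (intro tree_contract) (auto simp: spanning_tree_def)
    then show ?thesis using that(1) by (auto simp: spanning_tree_def contract_def)
  qed
  have "spanning_tree (contract T1 P) (contract G P)" "spanning_tree (contract T2 P) (contract G P)"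
    using span T block by blast+
  moreover have "edges (contract T1 P) \<inter> edges (contract T2 P) = {}"
    "edges (contract G P) = edges (contract T1 P) \<union> edges (contract T2 P)"
    using T by (auto simp: spanning_tree_def)
  ultimately show ?thesis
    using multigraph_contract[OF mG P] unfolding two_T_graph_def by blast
qed

section \<open>Generic components\<close>

definition circuit_connectivity :: "('v, 'e) mgraph \<Rightarrow> ('v \<times> 'v) set" where
  "circuit_connectivity G = {(u, v). \<exists>X\<in>generic_circuits G. u \<in> X \<and> v \<in> X}\<^sup>*"

lemma equiv_circuit_connectivity: "equiv UNIV (circuit_connectivity G)"
  unfolding circuit_connectivity_def
  by (intro equivI refl_rtrancl sym_rtrancl trans_rtrancl) (auto simp: sym_def)

lemma circuit_connectivityI:
  "X \<in> generic_circuits G \<Longrightarrow> u \<in> X \<Longrightarrow> v \<in> X \<Longrightarrow> (u, v) \<in> circuit_connectivity G"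
  unfolding circuit_connectivity_def by (rule r_into_rtrancl) auto

lemma circuit_connectivity_cases:
  assumes "(u, v) \<in> circuit_connectivity G"
  obtains "u = v" | X where "X \<in> generic_circuits G" "v \<in> X"
  using assms unfolding circuit_connectivity_def by (cases rule: rtranclE) auto

lemma generic_circuit_class_subset:
  assumes "X \<in> generic_circuits G" "x \<in> X" "(v, x) \<in> circuit_connectivity G"
  shows "X \<subseteq> circuit_connectivity G `` {v}"
proof
  fix y assume "y \<in> X"
  then have "(x, y) \<in> circuit_connectivity G" using assms by (intro circuit_connectivityI)
  then show "y \<in> circuit_connectivity G `` {v}"
    using assms(3) by (auto simp: circuit_connectivity_def)
qed

text \<open>
  The circuits contained in one class of the connectivity relation form a maximal connected set, and
  their union is the class, unless the class is a single vertex in no circuit.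
\<close>

lemma class_in_generic_components:
  assumes v: "v \<in> verts G"
  shows "circuit_connectivity G `` {v} \<in> generic_components G"
proof (cases "v \<in> \<Union>(generic_circuits G)")
  case False
  have "w = v" if "(v, w) \<in> circuit_connectivity G" for w
    using that unfolding circuit_connectivity_def
    by (cases rule: converse_rtranclE) (use False in auto)
  then have "circuit_connectivity G `` {v} = {v}" by (auto simp: circuit_connectivity_def)
  then show ?thesis using False v by (auto simp: generic_components_def)
next
  case True
  then obtain X where X: "X \<in> generic_circuits G" "v \<in> X" by blast
  let ?R = "circuit_connectivity G"
  define A where "A = ?R `` {v}"
  define S where "S = {Y \<in> generic_circuits G. Y \<subseteq> A}"
  have vA: "(v, v) \<in> ?R" by (simp add: circuit_connectivity_def)
  have XS: "X \<in> S" using X generic_circuit_class_subset[OF X vA] by (simp add: S_def A_def)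
  have comp: "hypergraph_components (verts G) (generic_circuits G) = verts G // ?R"
    by (simp add: hypergraph_components_def circuit_connectivity_def)
  have A: "A \<in> verts G // ?R" unfolding A_def using v by (rule quotientI)
  have "\<Union>S = A"
  proof
    show "A \<subseteq> \<Union>S"
    proof
      fix x assume x: "x \<in> A"
      then have vx: "(v, x) \<in> ?R" by (simp add: A_def)
      then show "x \<in> \<Union>S"
      proof (cases rule: circuit_connectivity_cases)
        case 1
        then show ?thesis using X XS by blast
      next
        case (2 Y)
        then show ?thesis using generic_circuit_class_subset[OF 2 vx] by (auto simp: S_def A_def)
      qed
    qed
  qed (auto simp: S_def)
  moreover have "connected_circuit_set G S"
    using XS A unfolding connected_circuit_set_def connected_circuits_def comp
    by (auto simp: S_def)
  moreover have "S' = S" if S': "connected_circuit_set G S'" "S \<subseteq> S'" for S'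
  proof -
    have "Y \<subseteq> A" if Y: "Y \<in> S'" for Y
    proof -
      obtain C where C: "C \<in> verts G // ?R" "X \<subseteq> C" "Y \<subseteq> C"
        using S' XS Y unfolding connected_circuit_set_def connected_circuits_def comp by blast
      then obtain w where "C = ?R `` {w}" by (blast elim: quotientE)
      moreover from this have "(w, v) \<in> ?R" using C(2) X(2) by blast
      ultimately have "C = A"
        using equiv_class_eq[OF equiv_circuit_connectivity] by (simp add: A_def)
      then show ?thesis using C by simp
    qed
    then show ?thesis using S' by (auto simp: S_def connected_circuit_set_def)
  qed
  ultimately show ?thesis unfolding A_def[symmetric] generic_components_def by blast
qed

text \<open>
  A generic component meets the class of each of its vertices in that vertex. As the class is itself a
  generic component, and only one generic component contains a given vertex, the two coincide.
\<close>

lemma generic_components_eq_quotient: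
  "generic_components G = verts G // circuit_connectivity G"
proof
  show "verts G // circuit_connectivity G \<subseteq> generic_components G"
    by (auto simp: quotient_def class_in_generic_components)
  show "generic_components G \<subseteq> verts G // circuit_connectivity G"
  proof
    fix C assume C: "C \<in> generic_components G"
    have "X \<noteq> {} \<and> X \<subseteq> verts G" if "X \<in> generic_circuits G" for X
      using that by (auto simp: generic_circuits_def generic_circuit_def)
    note circuit = this
    from C consider w where "C = {w}" "w \<in> verts G"
      | S where "C = \<Union>S" "S \<noteq> {}" "S \<subseteq> generic_circuits G"
      unfolding generic_components_def connected_circuit_set_def by blast
    then obtain v where v: "v \<in> C" "v \<in> verts G"
    proof cases
      case 2
      then obtain Y where "Y \<in> S" "Y \<in> generic_circuits G" by blast
      then show thesis using circuit[of Y] 2(1) that by blast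
    qed (use that in blast)
    have "v \<in> circuit_connectivity G `` {v}" by (simp add: circuit_connectivity_def)
    then have "C = circuit_connectivity G `` {v}"
      using generic_components_partition[OF v(2)] C v class_in_generic_components[OF v(2)] by blast
    then show "C \<in> verts G // circuit_connectivity G" using v by (simp add: quotientI)
  qed
qed

lemma circuit_class_in_verts:
  assumes "v \<in> verts G" shows "circuit_connectivity G `` {v} \<subseteq> verts G"
proof
  fix x assume "x \<in> circuit_connectivity G `` {v}"
  then have "(v, x) \<in> circuit_connectivity G" by simp
  then show "x \<in> verts G"
    by (cases rule: circuit_connectivity_cases) (use assms in \<open>auto simp: generic_circuits_def\<close>)
qed

lemma partition_on_generic_components: "partition_on (verts G) (generic_components G)"
proof -
  let ?R = "circuit_connectivity G"
  have self: "v \<in> ?R `` {v}" for v by (simp add: circuit_connectivity_def)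
  show ?thesis
    unfolding generic_components_eq_quotient partition_on_def disjoint_def
  proof (intro conjI ballI impI)
    show "\<Union>(verts G // ?R) = verts G"
    proof
      show "\<Union>(verts G // ?R) \<subseteq> verts G"
        using circuit_class_in_verts[of _ G] by (blast elim: quotientE)
      show "verts G \<subseteq> \<Union>(verts G // ?R)" using self quotientI by fast
    qed
    show "C \<inter> D = {}" if "C \<in> verts G // ?R" "D \<in> verts G // ?R" "C \<noteq> D" for C D
    proof -
      have "C \<in> UNIV // ?R" "D \<in> UNIV // ?R" using that by (auto simp: quotient_def)
      then show ?thesis using quotient_disj[OF equiv_circuit_connectivity] that(3) by blast
    qed
    show "{} \<notin> verts G // ?R" using self by (auto elim!: quotientE)
  qed
qed

lemma tight_generic_circuit:
  assumes "X \<in> generic_circuits G"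
  shows "tight G X"
proof -
  have "card (edges (induced G X)) = 2 * card X - 2" "card (edges (induced G X)) > 0" "X \<subseteq> verts G"
    using assms by (auto simp: generic_circuits_def generic_circuit_def)
  then show ?thesis unfolding tight_def by auto
qed

text \<open>
  A maximal tight subset of the component containing a given vertex absorbs every circuit that it
  meets, because the union with such a circuit is tight again. Being closed under circuits, it is the
  whole component. Starting from a single vertex also covers the components without circuits.
\<close>

lemma tight_generic_component:
  assumes G: "two_T_graph G" and C: "C \<in> generic_components G"
  shows "tight G C"
proof -
  let ?R = "circuit_connectivity G"
  obtain v where v: "v \<in> verts G" "C = ?R `` {v}"
    using C by (auto simp: generic_components_eq_quotient elim: quotientE)
  define F where "F = {W. tight G W \<and> v \<in> W \<and> W \<subseteq> C}"
  have "C \<subseteq> verts G" using circuit_class_in_verts v by simp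
  then have "finite C" using two_T_verts[OF G] finite_subset by blast
  then have "finite F" by (auto simp: F_def)
  moreover have "{v} \<in> F"
    using tight_singleton[OF two_T_verts(1)[OF G] v(1)] v(2)
    by (simp add: F_def circuit_connectivity_def)
  ultimately obtain W where W: "W \<in> F" and max: "\<And>Z. Z \<in> F \<Longrightarrow> W \<subseteq> Z \<Longrightarrow> W = Z"
    using finite_has_maximal[of F] by auto
  have closed: "X \<subseteq> W" if X: "X \<in> generic_circuits G" "x \<in> X" "x \<in> W" for X x
  proof -
    have "(v, x) \<in> ?R" using W X v by (auto simp: F_def)
    then have "X \<subseteq> C" using generic_circuit_class_subset[OF X(1,2)] v(2) by simp
    moreover have "tight G (W \<union> X)"
      using tight_Un[OF G _ tight_generic_circuit[OF X(1)], of W] X W by (auto simp: F_def)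
    ultimately have "W \<union> X \<in> F" using W by (auto simp: F_def)
    then show ?thesis using max[of "W \<union> X"] by blast
  qed
  have vW: "v \<in> W" "W \<subseteq> C" using W by (auto simp: F_def)
  have "x \<in> W" if "(v, x) \<in> ?R" for x
    using that unfolding circuit_connectivity_def
  proof (induction rule: rtrancl_induct)
    case (step y z)
    then show ?case using closed by blast
  qed (rule vW)
  then have "W = C" using vW v(2) by blast
  then show ?thesis using W by (simp add: F_def)
qed

section \<open>Iterating the quotient\<close>

lemma two_T_quotient:
  assumes "two_T_graph G" shows "two_T_graph (quotient_graph G)"
  unfolding quotient_graph_def
  using assms partition_on_generic_components tight_generic_component[OF assms]
  by (rule two_T_contract)

text \<open>
  In a minimal tight set with at least two vertices, every smaller set with at least two vertices
  misses the sparsity bound by one or more, which is what a generic circuit requires.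
\<close>

lemma ex_generic_circuit:
  assumes G: "two_T_graph G" and "card (verts G) \<ge> 2"
  shows "\<exists>X\<in>generic_circuits G. card X \<ge> 2"
proof -
  define F where "F = {X. tight G X \<and> card X \<ge> 2}"
  have "F \<subseteq> Pow (verts G)" by (auto simp: F_def tight_def)
  then have "finite F" using two_T_verts[OF G] finite_subset by blast
  moreover have "verts G \<in> F" using tight_verts[OF G] assms(2) by (simp add: F_def)
  ultimately obtain X where X: "X \<in> F" and min: "\<And>Z. Z \<in> F \<Longrightarrow> Z \<subseteq> X \<Longrightarrow> X = Z"
    using finite_has_minimal[of F] by auto
  let ?i = "\<lambda>Z. card (edges (induced G Z))"
  have XV: "X \<subseteq> verts G" "?i X + 2 = 2 * card X" "card X \<ge> 2"
    using X by (auto simp: F_def tight_def)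
  have sparse: "card (edges (induced (induced G X) Y)) \<le> 2 * card Y - 3"
    if Y: "Y \<subset> X" "2 \<le> card Y" for Y
  proof -
    have "Y \<noteq> {}" "Y \<subseteq> verts G" using Y XV by auto
    moreover have "\<not> tight G Y" using min[of Y] Y by (auto simp: F_def)
    ultimately have "?i Y + 2 < 2 * card Y" 
      using two_T_sparse[OF G, of Y] unfolding tight_def by linarith
    moreover have "edges (induced (induced G X) Y) = edges (induced G Y)" using Y by auto
    ultimately show ?thesis by simp
  qed
  have "?i X = 2 * card X - 2" "0 < ?i X" using XV by linarith+
  then have "generic_circuit (induced G X)"
    unfolding generic_circuit_def induced_simps(1)
    using multigraph_induced[OF two_T_verts(1)[OF G] XV(1)] sparse by (intro conjI allI impI) simp_all
  then show ?thesis using XV by (auto simp: generic_circuits_def)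
qed

text \<open>
  Two vertices of a generic circuit get the same image, so the contraction map is not injective.
\<close>

lemma card_verts_quotient_less:
  assumes G: "two_T_graph G" and "card (verts G) \<ge> 2"
  shows "card (verts (quotient_graph G)) < card (verts G)"
proof -
  let ?p = "contraction_map (generic_components G)"
  note P = partition_on_generic_components[of G]
  obtain X where X: "X \<in> generic_circuits G" "card X \<ge> 2" using ex_generic_circuit[OF assms] by blast
  then obtain u v where uv: "u \<in> X" "v \<in> X" "u \<noteq> v"
    by (metis One_nat_def card_le_Suc0_iff_eq card.infinite not_less_eq_eq numeral_2_eq_2 zero_le)
  have V: "u \<in> verts G" "v \<in> verts G" using X uv by (auto simp: generic_circuits_def)
  let ?C = "circuit_connectivity G `` {u}"
  have "u \<in> ?C" "v \<in> ?C" using circuit_connectivityI[OF X(1)] uv by auto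
  then have "?p u = ?p v"
    using contraction_map_eq_iff[OF P] class_in_generic_components[OF V(1)] by blast
  then have "\<not> inj_on ?p (verts G)" using uv V by (auto simp: inj_on_def)
  then have "card (?p ` verts G) \<noteq> card (verts G)"
    using two_T_verts[OF G] eq_card_imp_inj_on by blast
  then show ?thesis
    using card_image_le[of "verts G" ?p] two_T_verts[OF G] by (simp add: quotient_graph_def)
qed

lemma K1_graph_if_one_vertex:
  assumes G: "multigraph G" and "card (verts G) = 1"
  shows "K1_graph G"
proof -
  obtain v where v: "verts G = {v}" using assms(2) by (auto simp: card_1_singleton_iff)
  have False if "e \<in> edges G" for e by (rule edge_ends[OF G that]) (use v in auto)
  then show ?thesis using v by (auto simp: K1_graph_def)
qed

lemma ex_quotient_power_K1:
  assumes "two_T_graph G"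
  shows "\<exists>k. K1_graph ((quotient_graph ^^ k) G)"
  using assms
proof (induction "card (verts G)" arbitrary: G rule: less_induct)
  case less
  show ?case
  proof (cases "card (verts G) \<ge> 2")
    case True
    then obtain k where "K1_graph ((quotient_graph ^^ k) (quotient_graph G))"
      using less card_verts_quotient_less two_T_quotient by blast
    then show ?thesis by (intro exI[of _ "Suc k"]) (simp add: funpow_swap1)
  next
    case False
    have "card (verts G) \<noteq> 0" using two_T_verts[OF less.prems] by simp
    then have "card (verts G) = 1" using False by simp
    then have "K1_graph G" using two_T_verts[OF less.prems] K1_graph_if_one_vertex by blast
    then show ?thesis by (intro exI[of _ 0]) simp
  qed
qed

theorem theorem4p5:
  fixes G :: "('v, 'e) mgraph"
  assumes "two_T_graph G"
  shows "(\<exists>(k :: nat) Gs. (\<forall>i\<le>k. two_T_graph (Gs i)) \<and> Gs 0 = G \<and> K1_graph (Gs k) \<and>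
            (\<forall>i\<in>{1..k}. Gs i = quotient_graph (Gs (i - 1))))
         \<and> two_T_graph (quotient_graph G)"
proof
  obtain k where k: "K1_graph ((quotient_graph ^^ k) G)" using ex_quotient_power_K1[OF assms] ..
  have "two_T_graph ((quotient_graph ^^ i) G)" for i
    by (induction i) (simp_all add: assms two_T_quotient)
  moreover have "(quotient_graph ^^ i) G = quotient_graph ((quotient_graph ^^ (i - 1)) G)"
    if "i \<in> {1..k}" for i using that by (cases i) auto
  ultimately show "\<exists>(k :: nat) Gs. (\<forall>i\<le>k. two_T_graph (Gs i)) \<and> Gs 0 = G \<and> K1_graph (Gs k) \<and>
            (\<forall>i\<in>{1..k}. Gs i = quotient_graph (Gs (i - 1)))"
    using k by (intro exI[of _ k] exI[of _ "\<lambda>i. (quotient_graph ^^ i) G"]) simp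
  show "two_T_graph (quotient_graph G)" using assms by (rule two_T_quotient)
qed

end
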